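(* Let $$f(x)=\min_{1\le i\le r}\left\{\frac12x^TM_ix+u_i^Tx+\beta_i+P_i(x)\right\},\qquad x\in\mathbb{R}^n,$$ where $P_i$ are proper closed polyhedral functions, $M_i$ are symmetric $n\times n$ real matrices, $u_i\in\mathbb{R}^n$ and $\beta_i\in\mathbb{R}$, for $i=1,\ldots,r$. Suppose in addition that $f$ is continuous on $\mathrm{dom}\,\partial f$. Then $f$ is a KL function with an exponent of $\frac12$.
   Context: Closed means lower semicontinuous; proper means never $-\infty$ and not identically $+\infty$; $\mathrm{dom}\,f=\{x: f(x)<\infty\}$. A polyhedral function is one whose epigraph is a (convex) polyhedron. For a proper function $f$ and $x\in\mathrm{dom}\,f$, the regular subdifferential is $\widehat\partial f(x)=\{v: \liminf_{z\to x,z\ne x}\frac{f(z)-f(x)-\langle v,z-x\rangle}{\|z-x\|}\ge 0\}$ and the (limiting) subdifferential $\partial f(x)$ is the set of $v$ for which there exist $x^t\to x$ with $f(x^t)\to f(x)$ and $v^t\to v$ with $v^t\in\widehat\partial f(x^t)$ for each $t$; $\partial f(x)=\emptyset$ if $x\notin\mathrm{dom}\,f$. $\mathrm{dom}\,\partial f=\{x:\partial f(x)\ne\emptyset\}$. "$f$ is continuous on a set $S$" means that the restriction of $f$ to $S$ is continuous. A proper closed function $f$ has the KL property at $\bar x\in\mathrm{dom}\,\partial f$ with an exponent of $\alpha\in[0,1)$ if there exist $c,\epsilon>0$ and $\nu\in(0,\infty]$ such that $\mathrm{dist}(0,\partial f(x))\ge c\,(f(x)-f(\bar x))^\alpha$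 whenever $\|x-\bar x\|\le\epsilon$ and $f(\bar x)<f(x)<f(\bar x)+\nu$ (with $\mathrm{dist}(0,\emptyset)=+\infty$). It is a KL function with an exponent of $\alpha$ if it has the KL property with exponent $\alpha$ at every $\bar x\in\mathrm{dom}\,\partial f$. *)

theory Defs
  imports "HOL-Analysis.Analysis"
begin

definition proper_fun :: "('a \<Rightarrow> ereal) \<Rightarrow> bool" where
  "proper_fun f \<longleftrightarrow> (\<forall>x. f x \<noteq> -\<infinity>) \<and> (\<exists>x. f x \<noteq> \<infinity>)"

definition closed_fun :: "('a::topological_space \<Rightarrow> ereal) \<Rightarrow> bool" where
  "closed_fun f \<longleftrightarrow> (\<forall>x. f x \<le> Liminf (at x) f)"

definition eff_dom :: "('a \<Rightarrow> ereal) \<Rightarrow> 'a set" where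
  "eff_dom f = {x. f x < \<infinity>}"

(* The library's epigraph is for real-valued functions. *)
definition ereal_epigraph :: "('a \<Rightarrow> ereal) \<Rightarrow> ('a \<times> real) set" where
  "ereal_epigraph f = {(x, t). f x \<le> ereal t}"

definition polyhedral_fun :: "('a::euclidean_space \<Rightarrow> ereal) \<Rightarrow> bool" where
  "polyhedral_fun f \<longleftrightarrow> polyhedron (ereal_epigraph f)"

(* Meant for proper f, so that f x is finite on the effective domain and the
   extended-real quotient is well defined; the set is empty off that domain. *)
definition regular_subdiff :: "('a::real_inner \<Rightarrow> ereal) \<Rightarrow> 'a \<Rightarrow> 'a set" where
  "regular_subdiff f x =
     {v. x \<in> eff_dom f \<and>
         0 \<le> Liminf (at x) (\<lambda>z. (f z - f x - ereal (v \<bullet> (z - x))) / ereal (norm (z - x)))}"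

definition limiting_subdiff :: "('a::real_inner \<Rightarrow> ereal) \<Rightarrow> 'a \<Rightarrow> 'a set" where
  "limiting_subdiff f x =
     {v. x \<in> eff_dom f \<and>
         (\<exists>X V. X \<longlonglongrightarrow> x \<and> (\<lambda>t. f (X t)) \<longlonglongrightarrow> f x \<and> V \<longlonglongrightarrow> v \<and>
                (\<forall>t::nat. V t \<in> regular_subdiff f (X t)))}"

definition dom_subdiff :: "('a::real_inner \<Rightarrow> ereal) \<Rightarrow> 'a set" where
  "dom_subdiff f = {x. limiting_subdiff f x \<noteq> {}}"

(* Unlike the library's infdist, the distance to the empty set is infinite. *)
definition ext_infdist :: "'a::metric_space \<Rightarrow> 'a set \<Rightarrow> ereal" where
  "ext_infdist x A = (INF a\<in>A. ereal (dist x a))"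

(* For proper f, the conditions f xb < f x < f xb + nu make f x - f xb a positive
   finite number, so real_of_ereal does not lose information. *)
definition KL_property :: "('a::real_inner \<Rightarrow> ereal) \<Rightarrow> 'a \<Rightarrow> real \<Rightarrow> bool" where
  "KL_property f xb \<alpha> \<longleftrightarrow>
     xb \<in> dom_subdiff f \<and> 0 \<le> \<alpha> \<and> \<alpha> < 1 \<and>
     (\<exists>(c::real) (\<epsilon>::real) (\<nu>::ereal). 0 < c \<and> 0 < \<epsilon> \<and> 0 < \<nu> \<and>
        (\<forall>x. norm (x - xb) \<le> \<epsilon> \<and> f xb < f x \<and> f x < f xb + \<nu> \<longrightarrow>
             ereal (c * real_of_ereal (f x - f xb) powr \<alpha>)
               \<le> ext_infdist 0 (limiting_subdiff f x)))"

definition KL_function :: "('a::real_inner \<Rightarrow> ereal) \<Rightarrow> real \<Rightarrow> bool" where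
  "KL_function f \<alpha> \<longleftrightarrow>
     proper_fun f \<and> closed_fun f \<and> 0 \<le> \<alpha> \<and> \<alpha> < 1 \<and>
     (\<forall>xb \<in> dom_subdiff f. KL_property f xb \<alpha>)"

end

theory Submission
  imports Defs
begin

text \<open>
  Write \<open>f\<close> as the minimum of the functions \<open>f\<^sub>i = q\<^sub>i + P\<^sub>i\<close> with \<open>q\<^sub>i\<close> quadratic and \<open>P\<^sub>i\<close> polyhedral,
  and fix the level \<open>\<gamma> = f xb\<close>. The core is an estimate \<open>c * (f x - \<gamma>) \<le> (norm v)\<^sup>2\<close> for all points
  \<open>x\<close> with \<open>\<gamma> < f x < \<gamma> + \<nu>\<close> and all regular subgradients \<open>v\<close> of \<open>f\<close> at \<open>x\<close>. Its constants depend
  on the level only, not on the distance from \<open>x\<close> to \<open>xb\<close>. The estimate passes to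
  limiting subgradients, and its square root is the asserted inequality with exponent one half.

  A regular subgradient \<open>v\<close> of \<open>f\<close> at \<open>x\<close> is one of every piece \<open>f\<^sub>i\<close> that attains the minimum at \<open>x\<close>. If
  \<open>J\<close> is the set of constraints of the epigraph of \<open>P\<^sub>i\<close> that are active at \<open>(x, P\<^sub>i x)\<close>, then by
  Farkas' lemma \<open>(v - \<nabla>q\<^sub>i x, - 1)\<close> lies in the cone generated by their normals
  (\<open>frechet_subgradient_in_kkt_set\<close>). For fixed \<open>J\<close> these conditions on the point and on \<open>v\<close> are
  linear: they describe a polyhedron (\<open>polyhedron_kkt_set\<close>). There are only finitely many \<open>i\<close> and
  \<open>J\<close>, so it suffices to treat one polyhedron at a time.

  The points \<open>(x, t)\<close> of its slice at \<open>v = 0\<close> solve the equations of a critical point, and are called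
  critical here. If the slice is empty, the polyhedron stays at a
  positive distance from \<open>v = 0\<close> (\<open>polyhedron_empty_slice_gap\<close>), so \<open>norm v\<close> is bounded below and
  the estimate is clear. Otherwise Hoffman's error bound places every point of the polyhedron within
  \<open>C * norm v\<close> of a critical point (\<open>polyhedron_slice_error_bound\<close>). Between two points of the same
  polyhedron the values \<open>q\<^sub>i x + t\<close> differ by exactly \<open>v \<bullet> d - 1/2 * (d \<bullet> A d)\<close>, where \<open>d\<close> is the
  difference of the points and \<open>v\<close> the slope at the first (\<open>kkt_value_diff\<close>). Hence all critical points
  of the slice have the same value \<open>\<kappa>\<close>, and at a point of slope \<open>v\<close> the value differs from \<open>\<kappa>\<close> by at
  most \<open>D * (norm v)\<^sup>2\<close>. A value slightly above \<open>\<gamma>\<close> is at least as far from \<open>\<kappa>\<close> as from \<open>\<gamma>\<close>, which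
  gives the estimate.
\<close>

section \<open>Finitely generated cones and Hoffman's error bound\<close>

text \<open>A finitely generated cone is closed, so a vector outside it is strictly separated from it;
  the reversed separating vector is a direction \<open>d\<close> that violates the hypothesis.\<close>

lemma farkas_cone:
  fixes J :: "'a::euclidean_space set"
  assumes "finite J" and n: "\<And>d. (\<And>a. a \<in> J \<Longrightarrow> a \<bullet> d \<le> 0) \<Longrightarrow> n \<bullet> d \<le> 0"
  shows "n \<in> convex_cone hull J"
proof (rule ccontr)
  let ?C = "convex_cone hull J"
  assume "n \<notin> ?C"
  then obtain p b where pb: "p \<bullet> n < b" "\<And>x. x \<in> ?C \<Longrightarrow> b < p \<bullet> x"
    using separating_hyperplane_closed_point[of ?C n] closed_convex_cone_hull[OF \<open>finite J\<close>]
      convex_convex_cone_hull by blast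
  have "b < 0"
    using pb(2)[OF convex_cone_hull_contains_0] by simp
  have "a \<bullet> (- p) \<le> 0" if "a \<in> J" for a
  proof (rule ccontr)
    assume "\<not> a \<bullet> (- p) \<le> 0"
    then have neg: "p \<bullet> a < 0"
      by (simp add: inner_commute)
    have "(b / (p \<bullet> a)) *\<^sub>R a \<in> ?C"
      using that neg \<open>b < 0\<close> by (intro convex_cone_hull_mul hull_inc) (auto simp: divide_nonpos_neg)
    then show False
      using pb(2) neg by fastforce
  qed
  then have "n \<bullet> (- p) \<le> 0"
    by (rule n)
  then show False
    using pb(1) \<open>b < 0\<close> by (simp add: inner_commute)
qed

lemma convex_cone_hull_inner_le:
  assumes "n \<in> convex_cone hull J" and "\<And>a. a \<in> J \<Longrightarrow> a \<bullet> d \<le> 0"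
  shows "n \<bullet> d \<le> 0"
proof -
  have "convex_cone hull J \<subseteq> {x. d \<bullet> x \<le> 0}"
    using assms(2) by (intro hull_minimal convex_cone_halfspace_le) (auto simp: inner_commute)
  then show ?thesis
    using assms(1) by (auto simp: inner_commute)
qed

text \<open>Inactive constraints are slack and survive a short step in any direction; only the active
  ones restrict the direction.\<close>

lemma feasible_direction:
  fixes K :: "('a::real_inner \<times> real) set"
  assumes "finite K" and y: "\<And>a b. (a, b) \<in> K \<Longrightarrow> a \<bullet> y \<le> b"
    and d: "\<And>a b. (a, b) \<in> K \<Longrightarrow> a \<bullet> y = b \<Longrightarrow> a \<bullet> d \<le> 0"
  shows "\<forall>\<^sub>F s in at_right 0. \<forall>(a, b)\<in>K. a \<bullet> (y + s *\<^sub>R d) \<le> b"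
proof (rule eventually_ball_finite[OF \<open>finite K\<close>], clarify)
  fix a b assume ab: "(a, b) \<in> K"
  show "\<forall>\<^sub>F s in at_right 0. a \<bullet> (y + s *\<^sub>R d) \<le> b"
  proof (cases "a \<bullet> y = b")
    case True
    have "a \<bullet> (y + s *\<^sub>R d) \<le> b" if "0 < s" for s
      using d[OF ab True] True that by (simp add: inner_add_right mult_nonneg_nonpos)
    then show ?thesis
      by (auto simp: eventually_at_filter)
  next
    case False
    have "((\<lambda>s. a \<bullet> (y + s *\<^sub>R d)) \<longlongrightarrow> a \<bullet> (y + 0 *\<^sub>R d)) (at_right 0)"
      by (intro tendsto_intros)
    then have "\<forall>\<^sub>F s in at_right 0. a \<bullet> (y + s *\<^sub>R d) < b"
      using False y[OF ab] by (intro order_tendstoD(2)) auto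
    then show ?thesis
      by (rule eventually_mono) simp
  qed
qed

text \<open>The normal cone of a polyhedron at \<open>y\<close> is generated by the active constraint normals: by Farkas,
  a normal vector only has to be tested on directions that respect the active constraints, and these
  are feasible for a short step.\<close>

lemma normal_vector_in_active_cone:
  fixes K :: "('a::euclidean_space \<times> real) set"
  assumes "finite K" and y: "\<And>a b. (a, b) \<in> K \<Longrightarrow> a \<bullet> y \<le> b"
    and n: "\<And>z. (\<And>a b. (a, b) \<in> K \<Longrightarrow> a \<bullet> z \<le> b) \<Longrightarrow> n \<bullet> (z - y) \<le> 0"
  shows "n \<in> convex_cone hull (fst ` {(a, b)\<in>K. a \<bullet> y = b})"
proof (rule farkas_cone)
  show "finite (fst ` {(a, b)\<in>K. a \<bullet> y = b})"
    using \<open>finite K\<close> by (auto intro: finite_subset[of _ K])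
  fix d assume d: "\<And>a. a \<in> fst ` {(a, b)\<in>K. a \<bullet> y = b} \<Longrightarrow> a \<bullet> d \<le> 0"
  have "\<forall>\<^sub>F s in at_right 0. \<forall>(a, b)\<in>K. a \<bullet> (y + s *\<^sub>R d) \<le> b"
    using \<open>finite K\<close> y by (rule feasible_direction) (auto intro!: d simp: image_iff)
  moreover have "\<forall>\<^sub>F s in at_right (0::real). 0 < s"
    by (simp add: eventually_at_filter)
  ultimately have "\<forall>\<^sub>F s in at_right (0::real). 0 < s \<and> (\<forall>(a, b)\<in>K. a \<bullet> (y + s *\<^sub>R d) \<le> b)"
    by eventually_elim simp
  then obtain s :: real where s: "0 < s" "\<forall>(a, b)\<in>K. a \<bullet> (y + s *\<^sub>R d) \<le> b"
    using eventually_happens'[OF trivial_limit_at_right_real] by blast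
  then have "n \<bullet> ((y + s *\<^sub>R d) - y) \<le> 0"
    by (intro n) auto
  with s(1) show "n \<bullet> d \<le> 0"
    by (simp add: mult_le_0_iff)
qed

text \<open>A nonzero vector \<open>n\<close> of the cone generated by \<open>J\<close> has a positive inner product with some
  generator, since otherwise \<open>n \<bullet> n \<le> 0\<close>. Compactness of the unit vectors of the cone makes this
  quantitative.\<close>

lemma cone_vector_violation:
  fixes J :: "'a::euclidean_space set"
  assumes "finite J"
  obtains \<delta> where "0 < \<delta>"
    "\<And>n. n \<in> convex_cone hull J \<Longrightarrow> \<delta> * norm n \<le> (\<Sum>a\<in>J. max 0 (a \<bullet> n))"
proof -
  let ?m = "\<lambda>n. \<Sum>a\<in>J. max 0 (a \<bullet> n)"
  let ?N = "convex_cone hull J \<inter> sphere 0 1"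
  have pos: "0 < ?m n" if "n \<in> ?N" for n
  proof (rule ccontr)
    assume "\<not> 0 < ?m n"
    then have "?m n = 0"
      by (metis (no_types, lifting) sum_nonneg max.cobounded1 less_eq_real_def)
    then have "a \<bullet> n \<le> 0" if "a \<in> J" for a
      using that \<open>finite J\<close> by (simp add: sum_nonneg_eq_0_iff) (metis max.cobounded2)
    then have "n \<bullet> n \<le> 0"
      using that by (intro convex_cone_hull_inner_le[of n J]) auto
    then show False
      using that by (simp add: dot_square_norm)
  qed
  have "\<exists>\<delta>>0. \<forall>n\<in>?N. \<delta> \<le> ?m n"
  proof (cases "?N = {}")
    case True
    then show ?thesis
      by (metis equals0D zero_less_one)
  next
    case False
    have "compact ?N"
      using closed_convex_cone_hull[OF assms] by (simp add: closed_Int_compact)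
    moreover have "continuous_on ?N ?m"
      by (intro continuous_intros)
    ultimately obtain n0 where "n0 \<in> ?N" "\<forall>n\<in>?N. ?m n0 \<le> ?m n"
      using continuous_attains_inf[of ?N ?m] False by blast
    then show ?thesis
      using pos by blast
  qed
  then obtain \<delta> where \<delta>: "0 < \<delta>" "\<And>n. n \<in> ?N \<Longrightarrow> \<delta> \<le> ?m n"
    by blast
  show ?thesis
  proof
    fix n assume n: "n \<in> convex_cone hull J"
    show "\<delta> * norm n \<le> ?m n"
    proof (cases "n = 0")
      case False
      then have "n /\<^sub>R norm n \<in> ?N"
        using n by (auto intro: convex_cone_hull_mul)
      then have "\<delta> * norm n \<le> ?m (n /\<^sub>R norm n) * norm n"
        by (intro mult_right_mono \<delta>(2)) auto
      also have "\<dots> = ?m n"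
        using False by (simp add: sum_distrib_right max_mult_distrib_right flip: divide_inverse_commute)
      finally show ?thesis .
    qed (simp add: sum_nonneg)
  qed (fact \<delta>)
qed

text \<open>Hoffman's bound: the distance to a polyhedron is controlled by the largest constraint
  violation \<open>\<rho>\<close>. If \<open>y\<close> is the projection of \<open>z\<close>, then \<open>z - y\<close> lies in the cone of the constraints
  active at \<open>y\<close>, so by the previous lemma one of them grows at a definite rate from \<open>y\<close> to \<open>z\<close>, and
  its growth is at most \<open>\<rho>\<close>. There are only finitely many active sets, which yields one constant
  for all \<open>z\<close>.\<close>

proposition hoffman_error_bound:
  fixes K :: "('a::euclidean_space \<times> real) set"
  assumes "finite K" and feasible: "\<forall>(a, b)\<in>K. a \<bullet> z0 \<le> b"
  obtains C where "0 < C"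
    "\<And>z \<rho>. 0 \<le> \<rho> \<Longrightarrow> \<forall>(a, b)\<in>K. a \<bullet> z \<le> b + \<rho> \<Longrightarrow>
       \<exists>y. (\<forall>(a, b)\<in>K. a \<bullet> y \<le> b) \<and> norm (z - y) \<le> C * \<rho>"
proof -
  define Q where "Q = {z. \<forall>(a, b)\<in>K. a \<bullet> z \<le> b}"
  have Q_alt: "Q = (\<Inter>(a, b)\<in>K. {z. a \<bullet> z \<le> b})"
    by (auto simp: Q_def)
  have "convex Q" "closed Q"
    unfolding Q_alt by (auto intro!: convex_INT closed_INT convex_halfspace_le closed_halfspace_le)
  have "z0 \<in> Q"
    using feasible by (auto simp: Q_def)
  have "\<exists>\<delta>>0. \<forall>n\<in>convex_cone hull (fst ` J). \<delta> * norm n \<le> (\<Sum>a\<in>fst ` J. max 0 (a \<bullet> n))"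
    if "J \<subseteq> K" for J
  proof -
    have "finite (fst ` J)"
      using that \<open>finite K\<close> by (auto intro: finite_subset)
    then show ?thesis
      by (rule cone_vector_violation) auto
  qed
  then obtain \<delta> where \<delta>: "\<And>J. J \<subseteq> K \<Longrightarrow> 0 < \<delta> J"
    and \<delta>n: "\<And>J n. J \<subseteq> K \<Longrightarrow> n \<in> convex_cone hull (fst ` J) \<Longrightarrow>
          \<delta> J * norm n \<le> (\<Sum>a\<in>fst ` J. max 0 (a \<bullet> n))"
    by metis
  define C where "C = (\<Sum>J\<in>Pow K. card (fst ` J) / \<delta> J) + 1"
  have C: "card (fst ` J) / \<delta> J \<le> C" if "J \<subseteq> K" for J
    unfolding C_def using that \<delta> \<open>finite K\<close>
    by (intro add_increasing2 member_le_sum) (auto intro!: divide_nonneg_pos)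
  have "0 < C"
    unfolding C_def using \<delta> by (intro add_nonneg_pos sum_nonneg) (auto intro!: divide_nonneg_pos)
  show ?thesis
  proof
    fix z \<rho> assume "(0::real) \<le> \<rho>" and z: "\<forall>(a, b)\<in>K. a \<bullet> z \<le> b + \<rho>"
    define y where "y = closest_point Q z"
    define J where "J = {(a, b)\<in>K. a \<bullet> y = b}"
    have "J \<subseteq> K"
      by (auto simp: J_def)
    have "y \<in> Q"
      unfolding y_def using \<open>closed Q\<close> \<open>z0 \<in> Q\<close> by (intro closest_point_in_set) auto
    have "z - y \<in> convex_cone hull (fst ` J)"
      unfolding J_def
    proof (rule normal_vector_in_active_cone[OF \<open>finite K\<close>])
      show "a \<bullet> y \<le> b" if "(a, b) \<in> K" for a b
        using \<open>y \<in> Q\<close> that by (auto simp: Q_def)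
      show "(z - y) \<bullet> (w - y) \<le> 0" if "\<And>a b. (a, b) \<in> K \<Longrightarrow> a \<bullet> w \<le> b" for w
        unfolding y_def using that \<open>convex Q\<close> \<open>closed Q\<close>
        by (intro closest_point_dot) (auto simp: Q_def)
    qed
    then have "\<delta> J * norm (z - y) \<le> (\<Sum>a\<in>fst ` J. max 0 (a \<bullet> (z - y)))"
      using \<delta>n \<open>J \<subseteq> K\<close> by blast
    also have "\<dots> \<le> (\<Sum>a\<in>fst ` J. \<rho>)"
    proof (rule sum_mono)
      fix a assume "a \<in> fst ` J"
      then obtain b where "(a, b) \<in> K" "a \<bullet> y = b"
        by (auto simp: J_def)
      then show "max 0 (a \<bullet> (z - y)) \<le> \<rho>"
        using z \<open>0 \<le> \<rho>\<close> by (auto simp: inner_diff_right)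
    qed
    finally have "norm (z - y) \<le> card (fst ` J) / \<delta> J * \<rho>"
      using \<delta>[OF \<open>J \<subseteq> K\<close>] by (simp add: field_simps)
    also have "\<dots> \<le> C * \<rho>"
      using C[OF \<open>J \<subseteq> K\<close>] \<open>0 \<le> \<rho>\<close> by (rule mult_right_mono)
    finally show "\<exists>y. (\<forall>(a, b)\<in>K. a \<bullet> y \<le> b) \<and> norm (z - y) \<le> C * \<rho>"
      using \<open>y \<in> Q\<close> by (auto simp: Q_def)
  qed (fact \<open>0 < C\<close>)
qed

section \<open>Slices of polyhedra\<close>

lemma polyhedron_system:
  fixes S :: "'a::euclidean_space set"
  assumes "polyhedron S"
  obtains K where "finite K" "S = {x. \<forall>(a, b)\<in>K. a \<bullet> x \<le> b}"
proof -
  obtain F where F: "finite F" "S = \<Inter>F" "\<forall>h\<in>F. \<exists>a b. a \<noteq> 0 \<and> h = {x. a \<bullet> x \<le> b}"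
    using assms unfolding polyhedron_def by blast
  then obtain a b where ab: "\<And>h. h \<in> F \<Longrightarrow> h = {x. a h \<bullet> x \<le> b h}"
    by metis
  have "S = {x. \<forall>(a, b)\<in>(\<lambda>h. (a h, b h)) ` F. a \<bullet> x \<le> b}"
    using F(2) ab by auto
  with F(1) show ?thesis
    by (intro that[of "(\<lambda>h. (a h, b h)) ` F"]) auto
qed

lemma polyhedron_affine_preimage:
  fixes h :: "'a::euclidean_space \<Rightarrow> 'b::euclidean_space"
  assumes "polyhedron S" and "linear h"
  shows "polyhedron {x. h x + c \<in> S}"
proof -
  obtain K where K: "finite K" "S = {x. \<forall>(a, b)\<in>K. a \<bullet> x \<le> b}"
    using polyhedron_system[OF assms(1)] by blast
  have "{x. h x + c \<in> S} = (\<Inter>(a, b)\<in>K. {x. adjoint h a \<bullet> x \<le> b - a \<bullet> c})"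
    by (auto simp: K(2) inner_add_right adjoint_clauses(2)[OF assms(2)] algebra_simps split: prod.splits)
  then show ?thesis
    using K(1) by (auto intro!: polyhedron_Inter polyhedron_halfspace_le)
qed

text \<open>Think of the polyhedron as the graph of a multifunction from the perturbation \<open>v\<close> to the
  solutions \<open>x\<close>. Freezing \<open>v\<close> in the constraints at \<open>0\<close> turns a solution for \<open>v\<close> into a point
  that violates them by at most a multiple of \<open>norm v\<close>, and Hoffman's bound applies.\<close>

lemma polyhedron_slice_error_bound:
  fixes S :: "('a::euclidean_space \<times> 'b::euclidean_space) set"
  assumes "polyhedron S" and "(y0, 0) \<in> S"
  obtains C where "0 < C" "\<And>x v. (x, v) \<in> S \<Longrightarrow> \<exists>y. (y, 0) \<in> S \<and> norm (x - y) \<le> C * norm v"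
proof -
  obtain K where K: "finite K" "S = {x. \<forall>(a, b)\<in>K. a \<bullet> x \<le> b}"
    using polyhedron_system[OF assms(1)] by blast
  let ?K = "(\<lambda>(a, b). (fst a, b)) ` K"
  let ?L = "\<Sum>(a, b)\<in>K. norm (snd a)"
  have "finite ?K" and y0: "\<forall>(a, b)\<in>?K. a \<bullet> y0 \<le> b"
    using K assms(2) by (auto simp: inner_prod_def)
  obtain C where C: "0 < C" "\<And>z \<rho>. 0 \<le> \<rho> \<Longrightarrow> \<forall>(a, b)\<in>?K. a \<bullet> z \<le> b + \<rho> \<Longrightarrow>
       \<exists>y. (\<forall>(a, b)\<in>?K. a \<bullet> y \<le> b) \<and> norm (z - y) \<le> C * \<rho>"
    by (rule hoffman_error_bound[OF \<open>finite ?K\<close> y0]) (rule that)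
  have L: "0 \<le> ?L"
    by (intro sum_nonneg) auto
  show ?thesis
  proof
    show "0 < C * (?L + 1)"
      using C(1) L by simp
    fix x v assume xv: "(x, v) \<in> S"
    have "fst a \<bullet> x \<le> b + ?L * norm v" if "(a, b) \<in> K" for a b
    proof -
      have "fst a \<bullet> x \<le> b + (- snd a) \<bullet> v"
        using xv K(2) that by (force simp: inner_prod_def)
      also have "(- snd a) \<bullet> v \<le> norm (snd a) * norm v"
        using norm_cauchy_schwarz[of "- snd a" v] by simp
      also have "norm (snd a) * norm v \<le> ?L * norm v"
        using member_le_sum[OF that, of "\<lambda>(a, b). norm (snd a)"] K(1)
        by (intro mult_right_mono) auto
      finally show ?thesis
        by simp
    qed
    then have "\<forall>(a, b)\<in>?K. a \<bullet> x \<le> b + ?L * norm v"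
      by auto
    then obtain y where y: "\<forall>(a, b)\<in>?K. a \<bullet> y \<le> b" "norm (x - y) \<le> C * (?L * norm v)"
      using C(2)[of "?L * norm v" x] L by (meson mult_nonneg_nonneg norm_ge_zero)
    have "(y, 0) \<in> S"
      using y(1) by (auto simp: K(2) inner_prod_def)
    moreover have "C * (?L * norm v) \<le> C * (?L + 1) * norm v"
      using C(1) by (simp add: algebra_simps)
    ultimately show "\<exists>y. (y, 0) \<in> S \<and> norm (x - y) \<le> C * (?L + 1) * norm v"
      using y(2) by (meson order_trans)
  qed
qed

text \<open>The complementary case: if the unperturbed system is inconsistent, then so are all small
  perturbations. Homogenising makes the slice nonempty, so that the previous bound applies: it moves
  \<open>(x, 1)\<close> to some \<open>(y, s)\<close> in the slice of the homogenised system. There \<open>s > 0\<close> would give the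
  solution \<open>y /\<^sub>R s\<close> of the original system, hence the move has length at least 1.\<close>

lemma polyhedron_empty_slice_gap:
  fixes S :: "('a::euclidean_space \<times> 'b::euclidean_space) set"
  assumes "polyhedron S" and "\<And>y. (y, 0) \<notin> S"
  obtains \<delta> where "0 < \<delta>" "\<And>x v. (x, v) \<in> S \<Longrightarrow> \<delta> \<le> norm v"
proof -
  obtain K where K: "finite K" "S = {x. \<forall>(a, b)\<in>K. a \<bullet> x \<le> b}"
    using polyhedron_system[OF assms(1)] by blast
  define H where "H = {((x, s), v) | x s v. \<forall>(a, b)\<in>K. a \<bullet> (x, v) \<le> s * b}"
  have H_alt: "H = (\<Inter>(a, b)\<in>K. {w. ((fst a, - b), snd a) \<bullet> w \<le> 0})"
    by (auto simp: H_def inner_prod_def algebra_simps split: prod.splits)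
  have "polyhedron H"
    unfolding H_alt using K(1) by (auto intro!: polyhedron_Inter polyhedron_halfspace_le)
  moreover have "((0, 0), 0) \<in> H"
    by (auto simp: H_def inner_prod_def)
  ultimately obtain C where C: "0 < C"
    "\<And>w v. (w, v) \<in> H \<Longrightarrow> \<exists>y. (y, 0) \<in> H \<and> norm (w - y) \<le> C * norm v"
    using polyhedron_slice_error_bound by blast
  show ?thesis
  proof
    show "0 < 1 / C"
      using C(1) by simp
    fix x v assume "(x, v) \<in> S"
    then have "((x, 1), v) \<in> H"
      by (auto simp: H_def K(2))
    then obtain y s where ys: "((y, s), 0) \<in> H" "norm ((x, 1) - (y, s)) \<le> C * norm v"
      using C(2) by (metis surj_pair)
    have "\<not> 0 < s"
    proof
      assume "0 < s"
      then have "(y /\<^sub>R s, 0) \<in> S"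
        using ys(1) by (auto simp: H_def K(2) inner_prod_def field_simps)
      then show False
        using assms(2) by blast
    qed
    then have "1 \<le> norm (1 - s)"
      by simp
    also have "\<dots> \<le> C * norm v"
      using ys(2) norm_snd_le[of "1 - s" "x - y"] by simp
    finally show "1 / C \<le> norm v"
      using C(1) by (simp add: field_simps)
  qed
qed

section \<open>Critical points with a fixed set of active constraints\<close>

definition quadratic :: "('a::real_inner \<Rightarrow> 'a) \<Rightarrow> 'a \<Rightarrow> real \<Rightarrow> 'a \<Rightarrow> real" where
  "quadratic A u \<beta> x = 1/2 * (x \<bullet> A x) + u \<bullet> x + \<beta>"

lemma quadratic_expand:
  assumes "linear A" and sym: "\<And>x y. A x \<bullet> y = x \<bullet> A y"
  shows "quadratic A u \<beta> z =
    quadratic A u \<beta> x + (A x + u) \<bullet> (z - x) + 1/2 * ((z - x) \<bullet> A (z - x))"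
  using sym[of x z]
  by (simp add: quadratic_def linear_diff[OF \<open>linear A\<close>] algebra_simps inner_commute)

text \<open>The triples of a point \<open>x\<close>, a height \<open>t\<close> and a slope \<open>v\<close> such that \<open>(x, t)\<close> lies on the affine
  set where all constraints of \<open>J\<close> are tight and the gradient of \<open>v \<bullet> x - quadratic A u \<beta> x - t\<close> is
  a nonnegative combination of the constraint normals. When \<open>J\<close> is the set of active constraints of
  an epigraph this is the Karush-Kuhn-Tucker condition for \<open>(x, t)\<close>. Since \<open>J\<close> is fixed, the
  conditions are linear in all three variables.\<close>

definition kkt_set ::
    "('a::euclidean_space \<Rightarrow> 'a) \<Rightarrow> 'a \<Rightarrow> (('a \<times> real) \<times> real) set \<Rightarrow> (('a \<times> real) \<times> 'a) set" where
  "kkt_set A u J = {((x, t), v) | x t v.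
     (\<forall>(a, b)\<in>J. a \<bullet> (x, t) = b) \<and> (v - u - A x, - 1) \<in> convex_cone hull (fst ` J)}"

text \<open>The cone condition is an affine preimage of a finitely generated cone, which is polyhedral by
  Weyl's theorem.\<close>

lemma polyhedron_kkt_set:
  fixes A :: "'a::euclidean_space \<Rightarrow> 'a"
  assumes "finite J" and "linear A"
  shows "polyhedron (kkt_set A u J)"
proof -
  let ?h = "\<lambda>w :: ('a \<times> real) \<times> 'a. (snd w - A (fst (fst w)), 0::real)"
  have alt: "kkt_set A u J = (\<Inter>(a, b)\<in>J. {w. (a, 0) \<bullet> w = b}) \<inter>
      {w. ?h w + (- u, - 1) \<in> convex_cone hull (fst ` J)}"
    by (auto simp: kkt_set_def inner_prod_def algebra_simps split: prod.splits)
  have "linear ?h"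
    using \<open>linear A\<close>
    by (auto intro!: linearI simp: linear_add linear_scale algebra_simps)
  then show ?thesis
    unfolding alt using \<open>finite J\<close>
    by (intro polyhedron_Int polyhedron_Inter polyhedron_affine_preimage polyhedron_convex_cone_hull)
       (auto intro: polyhedron_hyperplane)
qed

text \<open>The difference of the points \<open>(x, t)\<close> and \<open>(x', t')\<close> is orthogonal to every normal in \<open>J\<close>, hence
  to the vector \<open>(v - u - A x, - 1)\<close> in their cone. This expresses \<open>t - t'\<close> through \<open>x - x'\<close>, and the
  exact expansion of the quadratic at \<open>x\<close> does the rest.\<close>

lemma kkt_value_diff:
  fixes A :: "'a::euclidean_space \<Rightarrow> 'a"
  assumes "linear A" and sym: "\<And>x y. A x \<bullet> y = x \<bullet> A y"
    and z: "((x, t), v) \<in> kkt_set A u J" and z': "((x', t'), v') \<in> kkt_set A u J"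
  shows "(quadratic A u \<beta> x + t) - (quadratic A u \<beta> x' + t') =
    v \<bullet> (x - x') - 1/2 * ((x - x') \<bullet> A (x - x'))"
proof -
  let ?n = "(v - u - A x, - 1 :: real)" and ?d = "(x - x', t - t')"
  have n: "?n \<in> convex_cone hull (fst ` J)"
    using z by (auto simp: kkt_set_def)
  have orth: "a \<bullet> ?d = 0" if "a \<in> fst ` J" for a
  proof -
    obtain b where "(a, b) \<in> J"
      using \<open>a \<in> fst ` J\<close> by auto
    then have "a \<bullet> (x, t) = b" "a \<bullet> (x', t') = b"
      using z z' by (auto simp: kkt_set_def simp del: inner_Pair)
    then show ?thesis
      using inner_diff_right[of a "(x, t)" "(x', t')"] by simp
  qed
  have "?n \<bullet> ?d \<le> 0"
    using orth by (intro convex_cone_hull_inner_le[OF n]) simp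
  moreover have "?n \<bullet> (- ?d) \<le> 0"
    using orth by (intro convex_cone_hull_inner_le[OF n]) (simp only: inner_minus_right orth minus_zero order_refl)
  ultimately have "(v - u - A x) \<bullet> (x - x') = t - t'"
    by (simp add: inner_diff_right)
  moreover have "quadratic A u \<beta> x' = quadratic A u \<beta> x - (A x + u) \<bullet> (x - x')
      + 1/2 * ((x - x') \<bullet> A (x - x'))"
    using quadratic_expand[OF assms(1,2), of u \<beta> x' x]
    by (simp add: linear_diff[OF \<open>linear A\<close>] inner_diff_left inner_diff_right algebra_simps)
  ultimately show ?thesis
    by (simp add: inner_diff_left inner_diff_right inner_add_left algebra_simps)
qed

text \<open>For two points of slope 0 the difference of values is the negative of the same symmetric
  expression in either order, so it vanishes: all critical points with multipliers in the same \<open>J\<close>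
  share one value \<open>\<kappa>\<close>. A point of slope \<open>v\<close> is within \<open>C * norm v\<close> of a critical point, and both
  terms in the value difference are then quadratic in \<open>norm v\<close>.\<close>

lemma kkt_value_bound:
  fixes A :: "'a::euclidean_space \<Rightarrow> 'a"
  assumes "finite J" and "linear A" and sym: "\<And>x y. A x \<bullet> y = x \<bullet> A y"
    and crit: "(y0, 0) \<in> kkt_set A u J"
  obtains \<kappa> D where "0 < D"
    "\<And>x t v. ((x, t), v) \<in> kkt_set A u J \<Longrightarrow>
       \<bar>quadratic A u \<beta> x + t - \<kappa>\<bar> \<le> D * (norm v)\<^sup>2"
proof -
  obtain x0 t0 where y0: "y0 = (x0, t0)"
    by (cases y0)
  define \<kappa> where "\<kappa> = quadratic A u \<beta> x0 + t0"
  have crit_value: "quadratic A u \<beta> x + t = \<kappa>" if "((x, t), 0) \<in> kkt_set A u J" for x t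
    using kkt_value_diff[OF assms(2,3) that crit[unfolded y0], of \<beta>]
      kkt_value_diff[OF assms(2,3) crit[unfolded y0] that, of \<beta>]
      linear_diff[OF \<open>linear A\<close>, of x x0] linear_diff[OF \<open>linear A\<close>, of x0 x]
    by (simp add: \<kappa>_def inner_diff_left inner_diff_right algebra_simps)
  obtain C where C: "0 < C" "\<And>z v. (z, v) \<in> kkt_set A u J \<Longrightarrow>
      \<exists>y. (y, 0) \<in> kkt_set A u J \<and> norm (z - y) \<le> C * norm v"
    using polyhedron_slice_error_bound[OF polyhedron_kkt_set[OF assms(1,2)] crit] by metis
  obtain B where B: "0 < B" "\<And>x. norm (A x) \<le> B * norm x"
    using linear_bounded_pos[OF \<open>linear A\<close>] by blast
  show ?thesis
  proof
    show "0 < C + 1/2 * (B * C\<^sup>2)"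
      using C(1) B(1) by (simp add: add_pos_pos)
    fix x t v assume xtv: "((x, t), v) \<in> kkt_set A u J"
    then obtain x' t' where y: "((x', t'), 0) \<in> kkt_set A u J" "norm ((x, t) - (x', t')) \<le> C * norm v"
      using C(2) by (metis surj_pair)
    let ?d = "x - x'"
    have d: "norm ?d \<le> C * norm v"
      using y(2) norm_fst_le[of ?d "t - t'"] by simp
    have "\<bar>v \<bullet> ?d\<bar> \<le> norm v * (C * norm v)"
      using Cauchy_Schwarz_ineq2[of v ?d] d by (meson mult_left_mono norm_ge_zero order_trans)
    moreover have "\<bar>?d \<bullet> A ?d\<bar> \<le> B * (C * norm v)\<^sup>2"
    proof -
      have "\<bar>?d \<bullet> A ?d\<bar> \<le> norm ?d * (B * norm ?d)"
        using Cauchy_Schwarz_ineq2[of ?d "A ?d"] B(2)[of ?d]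
        by (meson mult_left_mono norm_ge_zero order_trans)
      also have "\<dots> = B * (norm ?d)\<^sup>2"
        by (simp add: power2_eq_square)
      also have "\<dots> \<le> B * (C * norm v)\<^sup>2"
        using d B(1) by (intro mult_left_mono power_mono) auto
      finally show ?thesis .
    qed
    moreover have "quadratic A u \<beta> x + t - \<kappa> = v \<bullet> ?d - 1/2 * (?d \<bullet> A ?d)"
      using kkt_value_diff[OF assms(2,3) xtv y(1), of \<beta>] crit_value[OF y(1)] by simp
    ultimately have "\<bar>quadratic A u \<beta> x + t - \<kappa>\<bar>
        \<le> norm v * (C * norm v) + 1/2 * (B * (C * norm v)\<^sup>2)"
      by linarith
    then show "\<bar>quadratic A u \<beta> x + t - \<kappa>\<bar> \<le> (C + 1/2 * (B * C\<^sup>2)) * (norm v)\<^sup>2"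
      by (simp add: power2_eq_square algebra_simps)
  qed
qed

text \<open>The critical value \<open>\<kappa>\<close> may differ from the reference level \<open>\<gamma>\<close>. If \<open>\<kappa> \<le> \<gamma>\<close>, the gap to
  \<open>\<gamma>\<close> is at most the gap to \<open>\<kappa>\<close>. Otherwise \<open>\<nu>\<close> keeps the value in the lower half of
  the interval from \<open>\<gamma>\<close> to \<open>\<kappa>\<close>, where the same comparison holds. Without critical points the
  slope is bounded away from 0 and the value gap is at most 1.\<close>

lemma kkt_growth:
  fixes A :: "'a::euclidean_space \<Rightarrow> 'a"
  assumes "finite J" and "linear A" and sym: "\<And>x y. A x \<bullet> y = x \<bullet> A y"
  shows "\<exists>c>0. \<exists>\<nu>>0. \<forall>x t v. ((x, t), v) \<in> kkt_set A u J \<longrightarrow>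
    \<gamma> < quadratic A u \<beta> x + t \<longrightarrow> quadratic A u \<beta> x + t < \<gamma> + \<nu> \<longrightarrow>
    c * (quadratic A u \<beta> x + t - \<gamma>) \<le> (norm v)\<^sup>2"
proof (cases "\<exists>y. (y, 0) \<in> kkt_set A u J")
  case True
  then obtain \<kappa> D where D: "0 < D" "\<And>x t v. ((x, t), v) \<in> kkt_set A u J \<Longrightarrow>
      \<bar>quadratic A u \<beta> x + t - \<kappa>\<bar> \<le> D * (norm v)\<^sup>2"
    using kkt_value_bound[OF assms] by metis
  define \<nu> where "\<nu> = (if \<kappa> \<le> \<gamma> then 1 else (\<kappa> - \<gamma>) / 2)"
  have "1 / D * (quadratic A u \<beta> x + t - \<gamma>) \<le> (norm v)\<^sup>2"
    if "((x, t), v) \<in> kkt_set A u J" "quadratic A u \<beta> x + t < \<gamma> + \<nu>" for x t v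
  proof -
    have "quadratic A u \<beta> x + t - \<gamma> \<le> \<bar>quadratic A u \<beta> x + t - \<kappa>\<bar>"
      using that(2) by (auto simp: \<nu>_def field_simps split: if_splits)
    also have "\<dots> \<le> D * (norm v)\<^sup>2"
      using D(2) that(1) by blast
    finally show ?thesis
      using D(1) by (simp add: field_simps)
  qed
  moreover have "0 < \<nu>" "0 < 1 / D"
    using D(1) by (auto simp: \<nu>_def)
  ultimately show ?thesis
    by blast
next
  case False
  then obtain \<delta> where \<delta>: "0 < \<delta>" "\<And>z v. (z, v) \<in> kkt_set A u J \<Longrightarrow> \<delta> \<le> norm v"
    using polyhedron_empty_slice_gap[OF polyhedron_kkt_set[OF assms(1,2)]] by metis
  have "\<delta>\<^sup>2 * (quadratic A u \<beta> x + t - \<gamma>) \<le> (norm v)\<^sup>2"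
    if "((x, t), v) \<in> kkt_set A u J" "quadratic A u \<beta> x + t < \<gamma> + 1" for x t v
  proof -
    have "\<delta>\<^sup>2 * (quadratic A u \<beta> x + t - \<gamma>) \<le> \<delta>\<^sup>2 * 1"
      using that(2) by (intro mult_left_mono) auto
    also have "\<delta>\<^sup>2 * 1 \<le> (norm v)\<^sup>2"
      using \<delta> that(1) by (simp add: power_mono)
    finally show ?thesis .
  qed
  moreover have "0 < \<delta>\<^sup>2"
    using \<delta>(1) by simp
  ultimately show ?thesis
    by (meson zero_less_one)
qed

section \<open>Regular subgradients of a quadratic plus a polyhedral function\<close>

text \<open>Unfolds the lower limit into a first-order minorant, the only form in which regular
  subgradients enter the argument. This form passes to every majorant of \<open>f\<close> that agrees with it at
  \<open>x\<close>.\<close>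

lemma regular_subdiff_lower_bound:
  assumes "v \<in> regular_subdiff f x" and "f x = ereal y" and "0 < e"
  obtains \<delta> where "0 < \<delta>"
    "\<And>z. dist z x < \<delta> \<Longrightarrow> ereal (y + v \<bullet> (z - x) - e * norm (z - x)) \<le> f z"
proof -
  let ?q = "\<lambda>z. (f z - f x - ereal (v \<bullet> (z - x))) / ereal (norm (z - x))"
  have "\<forall>\<^sub>F z in at x. ereal (- e) < ?q z"
    using assms(1,3) unfolding regular_subdiff_def le_Liminf_iff by auto
  then obtain \<delta> where \<delta>: "0 < \<delta>" "\<And>z. z \<noteq> x \<Longrightarrow> dist z x < \<delta> \<Longrightarrow> ereal (- e) < ?q z"
    unfolding eventually_at by blast
  show ?thesis
  proof
    fix z assume z: "dist z x < \<delta>"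
    show "ereal (y + v \<bullet> (z - x) - e * norm (z - x)) \<le> f z"
    proof (cases "z = x")
      case False
      then have n: "0 < norm (z - x)"
        by simp
      have q: "ereal (- e) < (f z - ereal y - ereal (v \<bullet> (z - x))) / ereal (norm (z - x))"
        using \<delta>(2)[OF False z] assms(2) by simp
      show ?thesis
      proof (cases "f z")
        case (real r)
        then have "- e < (r - y - v \<bullet> (z - x)) / norm (z - x)"
          using q n by simp
        then have "- e * norm (z - x) < r - y - v \<bullet> (z - x)"
          using n by (simp add: field_simps)
        then show ?thesis
          using real by simp
      next
        case MInf
        then show ?thesis
          using q n by (simp add: divide_ereal_def)
      qed simp
    qed (simp add: assms(2))
  qed (fact \<delta>(1))
qed

text \<open>By Farkas it suffices to test directions \<open>d = (h, \<tau>)\<close> that respect the active constraints of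
  the epigraph. A short step along \<open>d\<close> stays in the epigraph, so \<open>p\<close> grows at rate at most \<open>\<tau>\<close> along
  \<open>h\<close>; comparing with the first-order minorant and letting the step length tend to 0 bounds
  \<open>(v - u - A x) \<bullet> h\<close> by \<open>\<tau>\<close>, up to an arbitrarily small error.\<close>

lemma frechet_subgradient_in_kkt_set:
  fixes A :: "'a::euclidean_space \<Rightarrow> 'a" and p :: "'a \<Rightarrow> ereal"
  assumes "linear A" and sym: "\<And>x y. A x \<bullet> y = x \<bullet> A y"
    and K: "finite K" "ereal_epigraph p = {z. \<forall>(a, b)\<in>K. a \<bullet> z \<le> b}"
    and t: "p x = ereal t"
    and v: "\<And>e. 0 < e \<Longrightarrow> \<exists>\<delta>>0. \<forall>z. dist z x < \<delta> \<longrightarrow>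
      ereal (quadratic A u \<beta> x + t + v \<bullet> (z - x) - e * norm (z - x)) \<le> ereal (quadratic A u \<beta> z) + p z"
  shows "((x, t), v) \<in> kkt_set A u {(a, b)\<in>K. a \<bullet> (x, t) = b}"
proof -
  let ?J = "{(a, b)\<in>K. a \<bullet> (x, t) = b}"
  have "(x, t) \<in> ereal_epigraph p"
    by (simp add: ereal_epigraph_def t)
  then have feasible: "a \<bullet> (x, t) \<le> b" if "(a, b) \<in> K" for a b
    using that by (auto simp: K(2))
  have "(v - u - A x, - 1) \<in> convex_cone hull (fst ` ?J)"
  proof (rule farkas_cone)
    show "finite (fst ` ?J)"
      using \<open>finite K\<close> by (auto intro: finite_subset[of _ K])
    fix d :: "'a \<times> real" assume d: "\<And>a. a \<in> fst ` ?J \<Longrightarrow> a \<bullet> d \<le> 0"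
    obtain h \<tau> where d_eq: "d = (h, \<tau>)"
      by (cases d)
    have dir: "\<forall>\<^sub>F s in at_right 0. \<forall>(a, b)\<in>K. a \<bullet> ((x, t) + s *\<^sub>R d) \<le> b"
      using \<open>finite K\<close> feasible
    proof (rule feasible_direction)
      show "a \<bullet> d \<le> 0" if "(a, b) \<in> K" "a \<bullet> (x, t) = b" for a b
        using that by (intro d image_eqI[of a fst "(a, b)"]) (simp_all del: inner_Pair)
    qed
    have "(v - u - A x) \<bullet> h - \<tau> \<le> e * norm h" if "0 < e" for e
    proof -
      obtain \<delta> where \<delta>: "0 < \<delta>" "\<And>z. dist z x < \<delta> \<Longrightarrow>
          ereal (quadratic A u \<beta> x + t + v \<bullet> (z - x) - e * norm (z - x)) \<le> ereal (quadratic A u \<beta> z) + p z"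
        using v[OF \<open>0 < e\<close>] by blast
      have "((\<lambda>s. dist (x + s *\<^sub>R h) x) \<longlongrightarrow> dist (x + 0 *\<^sub>R h) x) (at_right 0)"
        by (intro tendsto_intros)
      then have near: "\<forall>\<^sub>F s in at_right 0. dist (x + s *\<^sub>R h) x < \<delta>"
        using \<delta>(1) by (intro order_tendstoD(2)) auto
      have pos: "\<forall>\<^sub>F s in at_right (0::real). 0 < s"
        by (simp add: eventually_at_filter)
      have "\<forall>\<^sub>F s in at_right 0. (v - u - A x) \<bullet> h - \<tau> - e * norm h \<le> 1/2 * s * (h \<bullet> A h)"
        using dir near pos
      proof eventually_elim
        case (elim s)
        let ?z = "x + s *\<^sub>R h"
        have "(?z, t + s * \<tau>) \<in> ereal_epigraph p"
          using elim(1) by (simp add: K(2) d_eq)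
        then have "p ?z \<le> ereal (t + s * \<tau>)"
          by (simp add: ereal_epigraph_def)
        then have "ereal (quadratic A u \<beta> ?z) + p ?z \<le> ereal (quadratic A u \<beta> ?z + (t + s * \<tau>))"
          by (metis add_left_mono plus_ereal.simps(1))
        from order_trans[OF \<delta>(2)[OF elim(2)] this]
        have "quadratic A u \<beta> x + t + v \<bullet> (?z - x) - e * norm (?z - x)
            \<le> quadratic A u \<beta> ?z + (t + s * \<tau>)"
          by simp
        moreover have "quadratic A u \<beta> ?z =
            quadratic A u \<beta> x + s * ((A x + u) \<bullet> h) + s * (1/2 * s * (h \<bullet> A h))"
          using quadratic_expand[OF assms(1,2), of u \<beta> ?z x] by (simp add: linear_scale[OF \<open>linear A\<close>])
        ultimately have "s * ((v - u - A x) \<bullet> h - \<tau> - e * norm h) \<le> s * (1/2 * s * (h \<bullet> A h))"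
          using elim(3) by (simp add: algebra_simps inner_diff_left inner_add_left)
        then show ?case
          using elim(3) by simp
      qed
      moreover have "((\<lambda>s. 1/2 * s * (h \<bullet> A h)) \<longlongrightarrow> 1/2 * 0 * (h \<bullet> A h)) (at_right 0)"
        by (intro tendsto_intros)
      ultimately have "(v - u - A x) \<bullet> h - \<tau> - e * norm h \<le> 1/2 * 0 * (h \<bullet> A h)"
        by (intro tendsto_lowerbound) auto
      then show ?thesis
        by simp
    qed
    \<comment> \<open>The \<open>+ 1\<close> in the rescaled error covers the vertical directions \<open>h = 0\<close>.\<close>
    then have "(v - u - A x) \<bullet> h - \<tau> \<le> e" if "0 < e" for e
    proof -
      have "(v - u - A x) \<bullet> h - \<tau> \<le> e / (norm h + 1) * norm h"
        using \<open>\<And>e. 0 < e \<Longrightarrow> (v - u - A x) \<bullet> h - \<tau> \<le> e * norm h\<close>[of "e / (norm h + 1)"] that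
        by (simp add: add_nonneg_pos)
      also have "\<dots> \<le> e"
        using that by (simp add: pos_divide_le_eq add_nonneg_pos distrib_left)
      finally show ?thesis .
    qed
    then have "(v - u - A x) \<bullet> h - \<tau> \<le> 0"
      using field_le_epsilon[of "(v - u - A x) \<bullet> h - \<tau>" 0] by simp
    then show "(v - u - A x, - 1) \<bullet> d \<le> 0"
      by (simp add: d_eq)
  qed
  then show ?thesis
    by (auto simp: kkt_set_def)
qed

text \<open>A polyhedral epigraph has finitely many sets \<open>J\<close> of active constraints, so the constants can be
  chosen uniformly. The estimate is stated for subgradients of any minorant \<open>f\<close> of the sum that
  touches it at \<open>x\<close>, because a minimum of several such sums is a minorant of each of them.\<close>

lemma quadratic_plus_polyhedral_growth:
  fixes A :: "'a::euclidean_space \<Rightarrow> 'a" and p :: "'a \<Rightarrow> ereal"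
  assumes "linear A" and sym: "\<And>x y. A x \<bullet> y = x \<bullet> A y" and "polyhedral_fun p"
  shows "\<exists>c \<nu>. 0 < c \<and> 0 < \<nu> \<and> (\<forall>f x y v.
    (\<forall>z. f z \<le> ereal (quadratic A u \<beta> z) + p z) \<longrightarrow>
    f x = ereal y \<longrightarrow> ereal (quadratic A u \<beta> x) + p x = ereal y \<longrightarrow>
    v \<in> regular_subdiff f x \<longrightarrow> \<gamma> < y \<longrightarrow> y < \<gamma> + \<nu> \<longrightarrow> c * (y - \<gamma>) \<le> (norm v)\<^sup>2)"
proof -
  obtain K where K: "finite K" "ereal_epigraph p = {z. \<forall>(a, b)\<in>K. a \<bullet> z \<le> b}"
    using polyhedron_system assms(3) unfolding polyhedral_fun_def by blast
  have "\<forall>J\<in>Pow K. \<exists>c \<nu>. 0 < c \<and> 0 < \<nu> \<and> (\<forall>x t v. ((x, t), v) \<in> kkt_set A u J \<longrightarrow>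
      \<gamma> < quadratic A u \<beta> x + t \<longrightarrow> quadratic A u \<beta> x + t < \<gamma> + \<nu> \<longrightarrow>
      c * (quadratic A u \<beta> x + t - \<gamma>) \<le> (norm v)\<^sup>2)"
    using kkt_growth[OF _ assms(1,2)] finite_subset[OF _ K(1)] by (metis PowD)
  then obtain c \<nu> where c\<nu>: "\<And>J. J \<in> Pow K \<Longrightarrow> 0 < c J \<and> 0 < \<nu> J \<and>
      (\<forall>x t v. ((x, t), v) \<in> kkt_set A u J \<longrightarrow>
      \<gamma> < quadratic A u \<beta> x + t \<longrightarrow> quadratic A u \<beta> x + t < \<gamma> + \<nu> J \<longrightarrow>
      c J * (quadratic A u \<beta> x + t - \<gamma>) \<le> (norm v)\<^sup>2)"
    by metis
  have fin: "finite (Pow K)" "Pow K \<noteq> {}"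
    using K(1) by auto
  have "0 < Min (c ` Pow K)" "0 < Min (\<nu> ` Pow K)"
    using fin c\<nu> by auto
  moreover have "Min (c ` Pow K) * (y - \<gamma>) \<le> (norm v)\<^sup>2"
    if minorant: "\<And>z. f z \<le> ereal (quadratic A u \<beta> z) + p z"
      and y: "f x = ereal y" "ereal (quadratic A u \<beta> x) + p x = ereal y"
      and v: "v \<in> regular_subdiff f x" and level: "\<gamma> < y" "y < \<gamma> + Min (\<nu> ` Pow K)"
    for f x y v
  proof -
    obtain t where t: "p x = ereal t" "y = quadratic A u \<beta> x + t"
      using y(2) by (cases "p x") auto
    let ?J = "{(a, b)\<in>K. a \<bullet> (x, t) = b}"
    have J: "?J \<in> Pow K"
      by auto
    have "((x, t), v) \<in> kkt_set A u ?J"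
    proof (rule frechet_subgradient_in_kkt_set[OF assms(1,2) K t(1), where \<beta> = \<beta>])
      fix e :: real assume "0 < e"
      then obtain \<delta> where "0 < \<delta>"
        "\<And>z. dist z x < \<delta> \<Longrightarrow> ereal (y + v \<bullet> (z - x) - e * norm (z - x)) \<le> f z"
        using regular_subdiff_lower_bound[OF v y(1)] by metis
      then show "\<exists>\<delta>>0. \<forall>z. dist z x < \<delta> \<longrightarrow>
          ereal (quadratic A u \<beta> x + t + v \<bullet> (z - x) - e * norm (z - x))
            \<le> ereal (quadratic A u \<beta> z) + p z"
        using minorant order_trans unfolding t(2) by blast
    qed
    moreover have "Min (\<nu> ` Pow K) \<le> \<nu> ?J" "Min (c ` Pow K) \<le> c ?J"
      using fin(1) J by auto
    ultimately have "c ?J * (y - \<gamma>) \<le> (norm v)\<^sup>2"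
      using c\<nu>[OF J] level t(2) by auto
    moreover have "Min (c ` Pow K) * (y - \<gamma>) \<le> c ?J * (y - \<gamma>)"
      using level(1) \<open>Min (c ` Pow K) \<le> c ?J\<close> by (intro mult_right_mono) auto
    ultimately show ?thesis
      by linarith
  qed
  ultimately show ?thesis
    by blast
qed

lemma min_quadratic_plus_polyhedral_growth:
  fixes A :: "'i \<Rightarrow> 'a::euclidean_space \<Rightarrow> 'a" and p :: "'i \<Rightarrow> 'a \<Rightarrow> ereal"
  assumes I: "finite I" "I \<noteq> {}"
    and lin: "\<And>i. i \<in> I \<Longrightarrow> linear (A i)"
    and sym: "\<And>i x y. i \<in> I \<Longrightarrow> A i x \<bullet> y = x \<bullet> A i y"
    and poly: "\<And>i. i \<in> I \<Longrightarrow> polyhedral_fun (p i)"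
    and f: "\<And>x. f x = (MIN i\<in>I. ereal (quadratic (A i) (u i) (\<beta> i) x) + p i x)"
  shows "\<exists>c \<nu>. 0 < c \<and> 0 < \<nu> \<and> (\<forall>x y v. f x = ereal y \<longrightarrow> v \<in> regular_subdiff f x \<longrightarrow>
    \<gamma> < y \<longrightarrow> y < \<gamma> + \<nu> \<longrightarrow> c * (y - \<gamma>) \<le> (norm v)\<^sup>2)"
proof -
  let ?g = "\<lambda>i z. ereal (quadratic (A i) (u i) (\<beta> i) z) + p i z"
  have "\<exists>c \<nu>. 0 < c \<and> 0 < \<nu> \<and> (\<forall>f x y v. (\<forall>z. f z \<le> ?g i z) \<longrightarrow>
      f x = ereal y \<longrightarrow> ?g i x = ereal y \<longrightarrow> v \<in> regular_subdiff f x \<longrightarrow>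
      \<gamma> < y \<longrightarrow> y < \<gamma> + \<nu> \<longrightarrow> c * (y - \<gamma>) \<le> (norm v)\<^sup>2)"
    if "i \<in> I" for i
    using that by (intro quadratic_plus_polyhedral_growth lin sym poly)
  then obtain c \<nu> where c\<nu>: "\<And>i. i \<in> I \<Longrightarrow> 0 < c i \<and> 0 < \<nu> i \<and>
      (\<forall>f x y v. (\<forall>z. f z \<le> ?g i z) \<longrightarrow>
      f x = ereal y \<longrightarrow> ?g i x = ereal y \<longrightarrow> v \<in> regular_subdiff f x \<longrightarrow>
      \<gamma> < y \<longrightarrow> y < \<gamma> + \<nu> i \<longrightarrow> c i * (y - \<gamma>) \<le> (norm v)\<^sup>2)"
    by metis
  have "0 < Min (c ` I)" "0 < Min (\<nu> ` I)"
    using I c\<nu> by auto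
  moreover have "Min (c ` I) * (y - \<gamma>) \<le> (norm v)\<^sup>2"
    if y: "f x = ereal y" and v: "v \<in> regular_subdiff f x"
      and level: "\<gamma> < y" "y < \<gamma> + Min (\<nu> ` I)" for x y v
  proof -
    have "f x \<in> (\<lambda>i. ?g i x) ` I"
      unfolding f using I by (intro Min_in) auto
    then obtain i where i: "i \<in> I" "?g i x = ereal y"
      using y by force
    have "f z \<le> ?g i z" for z
      unfolding f using I i(1) by (intro Min_le) auto
    moreover have "Min (\<nu> ` I) \<le> \<nu> i" and c: "Min (c ` I) \<le> c i"
      using I(1) i(1) by auto
    ultimately have "c i * (y - \<gamma>) \<le> (norm v)\<^sup>2"
      using c\<nu>[OF i(1)] i(2) y v level by (meson add_left_mono order_less_le_trans)
    moreover have "Min (c ` I) * (y - \<gamma>) \<le> c i * (y - \<gamma>)"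
      using level(1) c by (intro mult_right_mono) auto
    ultimately show ?thesis
      by linarith
  qed
  ultimately show ?thesis
    by blast
qed

section \<open>Passage to limiting subgradients\<close>

text \<open>Both the value constraints, being open, and the estimate, being closed, pass to the limit along
  a sequence that defines a limiting subgradient.\<close>

lemma limiting_subdiff_growth:
  fixes f :: "'a::real_inner \<Rightarrow> ereal"
  assumes growth: "\<And>x y v. f x = ereal y \<Longrightarrow> v \<in> regular_subdiff f x \<Longrightarrow>
      \<gamma> < y \<Longrightarrow> y < \<gamma> + \<nu> \<Longrightarrow> c * (y - \<gamma>) \<le> (norm v)\<^sup>2"
    and y: "f x = ereal y" and v: "v \<in> limiting_subdiff f x" and level: "\<gamma> < y" "y < \<gamma> + \<nu>"
  shows "c * (y - \<gamma>) \<le> (norm v)\<^sup>2"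
proof -
  obtain X V where XV: "(\<lambda>k. f (X k)) \<longlonglongrightarrow> ereal y" "V \<longlonglongrightarrow> v" "\<And>k. V k \<in> regular_subdiff f (X k)"
    using v y unfolding limiting_subdiff_def by auto
  have "\<forall>\<^sub>F k in sequentially. ereal \<gamma> < f (X k)" "\<forall>\<^sub>F k in sequentially. f (X k) < ereal (\<gamma> + \<nu>)"
    using order_tendstoD[OF XV(1)] level by auto
  then have "\<forall>\<^sub>F k in sequentially. c * (real_of_ereal (f (X k)) - \<gamma>) \<le> (norm (V k))\<^sup>2"
  proof eventually_elim
    case (elim k)
    then show ?case
      using growth[OF _ XV(3)[of k]] by (cases "f (X k)") auto
  qed
  moreover have "(\<lambda>k. real_of_ereal (f (X k))) \<longlonglongrightarrow> y"
    using XV(1) by (rule lim_real_of_ereal)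
  then have "(\<lambda>k. c * (real_of_ereal (f (X k)) - \<gamma>)) \<longlonglongrightarrow> c * (y - \<gamma>)"
    by (intro tendsto_mult tendsto_diff tendsto_const)
  moreover have "(\<lambda>k. (norm (V k))\<^sup>2) \<longlonglongrightarrow> (norm v)\<^sup>2"
    using XV(2) by (intro tendsto_intros)
  ultimately show ?thesis
    by (intro tendsto_le[OF trivial_limit_sequentially])
qed

text \<open>The growth estimate holds at all points whose values are slightly above \<open>\<gamma>\<close>, so the radius of
  the neighbourhood is arbitrary.\<close>

lemma KL_property_half:
  fixes f :: "'a::real_inner \<Rightarrow> ereal"
  assumes xb: "xb \<in> dom_subdiff f" "f xb = ereal \<gamma>" and "0 < c" "0 < \<nu>"
    and growth: "\<And>x y v. f x = ereal y \<Longrightarrow> v \<in> regular_subdiff f x \<Longrightarrow>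
      \<gamma> < y \<Longrightarrow> y < \<gamma> + \<nu> \<Longrightarrow> c * (y - \<gamma>) \<le> (norm v)\<^sup>2"
  shows "KL_property f xb (1/2)"
proof -
  have "ereal (sqrt c * real_of_ereal (f x - f xb) powr (1/2)) \<le> ext_infdist 0 (limiting_subdiff f x)"
    if level: "f xb < f x" "f x < f xb + ereal \<nu>" for x
  proof -
    obtain y where y: "f x = ereal y" "\<gamma> < y" "y < \<gamma> + \<nu>"
      using level xb(2) by (cases "f x") auto
    have "sqrt c * sqrt (y - \<gamma>) \<le> norm v" if "v \<in> limiting_subdiff f x" for v
    proof -
      have "c * (y - \<gamma>) \<le> (norm v)\<^sup>2"
        using growth y(1) that y(2,3) by (rule limiting_subdiff_growth)
      then show ?thesis
        by (metis norm_ge_zero real_le_lsqrt real_sqrt_mult)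
    qed
    then show ?thesis
      using y xb(2) by (auto simp: ext_infdist_def powr_half_sqrt intro!: INF_greatest)
  qed
  then have "\<exists>c \<epsilon> \<nu>. 0 < c \<and> (0::real) < \<epsilon> \<and> (0::ereal) < \<nu> \<and>
      (\<forall>x. norm (x - xb) \<le> \<epsilon> \<and> f xb < f x \<and> f x < f xb + \<nu> \<longrightarrow>
        ereal (c * real_of_ereal (f x - f xb) powr (1/2)) \<le> ext_infdist 0 (limiting_subdiff f x))"
    using assms(3,4) by (intro exI[of _ "sqrt c"] exI[of _ 1] exI[of _ "ereal \<nu>"]) auto
  then show ?thesis
    using xb(1) by (simp add: KL_property_def)
qed

section \<open>Minima of finitely many functions\<close>

lemma proper_fun_Min:
  assumes I: "finite I" "I \<noteq> {}" and proper: "\<And>i. i \<in> I \<Longrightarrow> proper_fun (g i)"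
  shows "proper_fun (\<lambda>x. MIN i\<in>I. g i x)"
  unfolding proper_fun_def
proof (intro conjI allI)
  show "(MIN i\<in>I. g i x) \<noteq> - \<infinity>" for x
  proof -
    have "(MIN i\<in>I. g i x) \<in> (\<lambda>i. g i x) ` I"
      using I by (intro Min_in) auto
    then obtain i where "i \<in> I" "(MIN i\<in>I. g i x) = g i x"
      by auto
    then show ?thesis
      using proper unfolding proper_fun_def by metis
  qed
  obtain i x where "i \<in> I" "g i x \<noteq> \<infinity>"
    by (metis I(2) proper proper_fun_def ex_in_conv)
  then have "(MIN i\<in>I. g i x) \<noteq> \<infinity>"
    by (metis I(1) Min_le finite_imageI imageI ereal_infty_less_eq(1))
  then show "\<exists>x. (MIN i\<in>I. g i x) \<noteq> \<infinity>" ..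
qed

lemma closed_fun_Min:
  fixes g :: "'i \<Rightarrow> 'a::topological_space \<Rightarrow> ereal"
  assumes I: "finite I" "I \<noteq> {}" and closed: "\<And>i. i \<in> I \<Longrightarrow> closed_fun (g i)"
  shows "closed_fun (\<lambda>x. MIN i\<in>I. g i x)"
  unfolding closed_fun_def le_Liminf_iff
proof (intro allI impI)
  fix x y assume y: "y < (MIN i\<in>I. g i x)"
  have "\<forall>\<^sub>F z in at x. \<forall>i\<in>I. y < g i z"
  proof (rule eventually_ball_finite[OF I(1)], rule ballI)
    fix i assume "i \<in> I"
    then have "y < g i x"
      using y I by simp
    then show "\<forall>\<^sub>F z in at x. y < g i z"
      using closed[OF \<open>i \<in> I\<close>] unfolding closed_fun_def le_Liminf_iff by blast
  qed
  then show "\<forall>\<^sub>F z in at x. y < (MIN i\<in>I. g i z)"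
    by eventually_elim (use I in auto)
qed

text \<open>A real number \<open>m\<close> between \<open>y - q x\<close> and \<open>p x\<close> splits the strict inequality into one part that
  the continuity of \<open>q\<close> preserves and one that the lower semicontinuity of \<open>p\<close> preserves.\<close>

lemma closed_fun_add_continuous:
  fixes q :: "'a::topological_space \<Rightarrow> real" and p :: "'a \<Rightarrow> ereal"
  assumes "continuous_on UNIV q" and "closed_fun p" and "\<And>x. p x \<noteq> - \<infinity>"
  shows "closed_fun (\<lambda>x. ereal (q x) + p x)"
  unfolding closed_fun_def le_Liminf_iff
proof (intro allI impI)
  fix x y assume "y < ereal (q x) + p x"
  then have "y - ereal (q x) < p x"
    by (cases y; cases "p x") auto
  then obtain m where m: "y - ereal (q x) < ereal m" "ereal m < p x"
    using ereal_dense2 by blast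
  then have "y < ereal (q x + m)"
    by (cases y) auto
  moreover have "((\<lambda>z. ereal (q z + m)) \<longlongrightarrow> ereal (q x + m)) (at x)"
    using assms(1) by (intro tendsto_intros) (simp add: continuous_on_def)
  ultimately have "\<forall>\<^sub>F z in at x. y < ereal (q z + m)"
    by (metis order_tendstoD(1))
  moreover have "\<forall>\<^sub>F z in at x. ereal m < p z"
    using assms(2) m(2) unfolding closed_fun_def le_Liminf_iff by blast
  ultimately show "\<forall>\<^sub>F z in at x. y < ereal (q z) + p z"
  proof eventually_elim
    case (elim z)
    have "ereal (q z + m) \<le> ereal (q z) + p z"
      using elim(2) by (cases "p z") auto
    with elim(1) show ?case
      by (rule less_le_trans)
  qed
qed

section \<open>The Kurdyka-Lojasiewicz exponent\<close>

theorem corollary5p2: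
  fixes r :: nat
    and M :: "nat \<Rightarrow> real ^ 'n ^ 'n"
    and u :: "nat \<Rightarrow> real ^ 'n"
    and \<beta> :: "nat \<Rightarrow> real"
    and P :: "nat \<Rightarrow> real ^ 'n \<Rightarrow> ereal"
    and f :: "real ^ 'n \<Rightarrow> ereal"
  assumes "1 \<le> r"
    and "\<And>i. i \<in> {1..r} \<Longrightarrow> transpose (M i) = M i"
    and "\<And>i. i \<in> {1..r} \<Longrightarrow> proper_fun (P i)"
    and "\<And>i. i \<in> {1..r} \<Longrightarrow> closed_fun (P i)"
    and "\<And>i. i \<in> {1..r} \<Longrightarrow> polyhedral_fun (P i)"
    and "\<And>x. f x = (MIN i\<in>{1..r}.
           ereal (1/2 * (x \<bullet> (M i *v x)) + u i \<bullet> x + \<beta> i) + P i x)"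
    and "continuous_on (dom_subdiff f) f"
  shows "KL_function f (1/2)"
proof -
  let ?A = "\<lambda>i x. M i *v x"
  let ?g = "\<lambda>i x. ereal (quadratic (?A i) (u i) (\<beta> i) x) + P i x"
  have I: "finite {1..r}" "{1..r} \<noteq> {}"
    using assms(1) by auto
  have f: "f x = (MIN i\<in>{1..r}. ?g i x)" for x
    by (simp add: assms(6) quadratic_def)
  have sym: "?A i x \<bullet> y = x \<bullet> ?A i y" if "i \<in> {1..r}" for i x y
    by (metis assms(2) that transpose_matrix_vector dot_lmul_matrix)
  have notMInf: "P i x \<noteq> - \<infinity>" if "i \<in> {1..r}" for i x
    using assms(3)[OF that] by (simp add: proper_fun_def)
  have "proper_fun (?g i)" if "i \<in> {1..r}" for i
    using assms(3)[OF that] by (simp add: proper_fun_def)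
  then have "proper_fun f"
    using proper_fun_Min[OF I, of ?g] by (simp add: f[abs_def])
  have "continuous_on UNIV (quadratic (?A i) (u i) (\<beta> i))" for i
    unfolding quadratic_def
    by (intro continuous_intros linear_continuous_on matrix_vector_mul_bounded_linear)
  then have "closed_fun (?g i)" if "i \<in> {1..r}" for i
    using assms(4)[OF that] notMInf[OF that] by (rule closed_fun_add_continuous)
  then have "closed_fun f"
    using closed_fun_Min[OF I, of ?g] by (simp add: f[abs_def])
  have "KL_property f xb (1/2)" if xb: "xb \<in> dom_subdiff f" for xb
  proof -
    have "f xb < \<infinity>"
      using xb by (auto simp: dom_subdiff_def limiting_subdiff_def eff_dom_def)
    then obtain \<gamma> where \<gamma>: "f xb = ereal \<gamma>"
      using \<open>proper_fun f\<close> by (cases "f xb") (auto simp: proper_fun_def)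
    obtain c \<nu> where "0 < c" "0 < \<nu>" and growth: "\<And>x y v. f x = ereal y \<Longrightarrow>
        v \<in> regular_subdiff f x \<Longrightarrow> \<gamma> < y \<Longrightarrow> y < \<gamma> + \<nu> \<Longrightarrow> c * (y - \<gamma>) \<le> (norm v)\<^sup>2"
      using min_quadratic_plus_polyhedral_growth[OF I matrix_vector_mul_linear sym assms(5) f, of \<gamma>]
      by blast
    with xb \<gamma> show ?thesis
      by (intro KL_property_half)
  qed
  with \<open>proper_fun f\<close> \<open>closed_fun f\<close> show ?thesis
    by (simp add: KL_function_def)
qed

end
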